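(* Let $q\ge 1$ and $m\ge 1$ be integers, let $r(\lambda)$ and $p_1(\lambda),\dots,p_m(\lambda)$ be rational functions and let $c_1,\dots,c_m\in[0,1]$ be distinct real numbers, such that the following three conditions hold. (P1) $|r(-\lambda)|<1$ for all $\lambda>0$; there is a constant $c$ with $|p_i(-\lambda)|\le c$ for all $i=1,\dots,m$ and all $\lambda>0$; and the numerator of each $p_i(\lambda)$ is of lower degree than its denominator. (P2) As $\lambda\to 0$, $r(-\lambda)=e^{-\lambda}+O(\lambda^{q+1})$, and for every integer $0\le j\le q$, $$\sum_{i=1}^m c_i^j p_i(-\lambda)-\frac{j!}{(-\lambda)^{j+1}}\Big(e^{-\lambda}-\sum_{\ell=0}^j\frac{(-\lambda)^\ell}{\ell!}\Big)=O(\lambda^{q-j}).$$ (P3) $|r(-\infty)|<1$, where $r(-\infty)=\lim_{\lambda\to\infty}r(-\lambda)$. Then there exists a threshold $J_*>0$ such that for all integers $J\ge J_*$, $$\sup_{s\in(0,\infty)}\left|\frac{(1+s)\,r(-s/J)^J-1}{s}\right|\le 0.3 .$$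
   Context: The convention $c_i^0=1$ is used (also when $c_i=0$). $J$ denotes a positive integer (the ratio between a coarse and a fine time step). *)

theory Defs
  imports
    "HOL-Analysis.Analysis"
    "HOL-Computational_Algebra.Computational_Algebra"
    "HOL-Computational_Algebra.Field_as_Ring"
    "HOL-Library.Landau_Symbols"
begin

text \<open>
  A rational function over \<open>'a\<close> is an element of the fraction field \<open>'a poly fract\<close>.
  Numerator and denominator are taken in lowest terms, with normalised denominator.
\<close>

definition rat_numer :: "'a::field_gcd poly fract \<Rightarrow> 'a poly" where
  "rat_numer f = fst (quot_of_fract f)"

definition rat_denom :: "'a::field_gcd poly fract \<Rightarrow> 'a poly" where
  "rat_denom f = snd (quot_of_fract f)"

text \<open>
  At a pole \<open>rat_eval\<close> returns the junk value \<open>0\<close>, so a bound on its values does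
  not by itself exclude poles.  Wherever a rational function is meant to be finite on a set,
  \<open>pole_free_at\<close> has to be required explicitly.
\<close>

definition rat_eval :: "'a::field_gcd poly fract \<Rightarrow> 'a \<Rightarrow> 'a" where
  "rat_eval f x = poly (rat_numer f) x / poly (rat_denom f) x"

definition pole_free_at :: "'a::field_gcd poly fract \<Rightarrow> 'a \<Rightarrow> bool" where
  "pole_free_at f x \<longleftrightarrow> poly (rat_denom f) x \<noteq> 0"

text \<open>
  The zero polynomial has degree \<open>0\<close> in HOL, whereas here its degree counts as
  \<open>-\<infinity>\<close>: the zero rational function (numerator \<open>0\<close>, denominator \<open>1\<close>) is strictly proper.
\<close>

definition strictly_proper :: "'a::field_gcd poly fract \<Rightarrow> bool" where
  "strictly_proper f \<longleftrightarrow> rat_numer f = 0 \<or> degree (rat_numer f) < degree (rat_denom f)"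

end

theory Submission
  imports Defs
begin

text \<open>
  Write \<open>f l = r(-l)\<close> and \<open>s = J l\<close>.  Since \<open>f\<close> agrees with
  \<open>exp (-l)\<close> up to \<open>O(l^2)\<close> near \<open>0\<close>, the power
  \<open>f (s / J) ^ J\<close> tends to \<open>exp (-s)\<close> as \<open>J\<close> grows, and the quantity to be bounded
  tends to \<open>((1 + s) exp (-s) - 1) / s\<close>.

  The limit is explicit, and its absolute value is at most \<open>144/481 < 0.3\<close>
  (\<open>one_minus_Suc_exp_le\<close>).  The true supremum is about \<open>0.2984\<close>, so there is little room
  and the constant has to be chosen with care.

  The convergence is uniform in \<open>s > 0\<close>, even after multiplication with the weight
  \<open>(1 + s) / s\<close> (\<open>power_tendsto_exp_weighted_uniformly\<close>), so the remaining gap below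
  \<open>0.3\<close> absorbs the error for all large \<open>J\<close>.  Uniformity needs two regimes.  For
  \<open>l\<close> below some \<open>\<delta>\<close> both \<open>f l\<close> and \<open>exp (-l)\<close> are bounded by
  \<open>exp (-l/2)\<close>, so telescoping the difference of the powers gives an error of order
  \<open>1/J\<close> times a factor \<open>exp (-s/4)\<close> that beats the polynomial growth in \<open>s\<close>.  For
  \<open>l \<ge> \<delta>\<close> both are bounded by one constant \<open>\<rho> < 1\<close>: for \<open>f\<close> this is where
  stability on the open half-line, stability at infinity and continuity (the absence of poles) are
  combined.  The difference of the powers is then of order \<open>\<rho> ^ J\<close>.
\<close>

section \<open>The limiting function\<close>

text \<open>
  Equivalently, \<open>\<phi> s = exp s * (1 - \<kappa> s) / (1 + s)\<close> stays below \<open>1\<close> for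
  \<open>\<kappa> = 144/481\<close>.  The critical points of \<open>\<phi>\<close> are the roots of
  \<open>\<kappa> s\<^sup>2 - (1 - \<kappa>) s + \<kappa>\<close>; they are mutually reciprocal, and \<open>\<kappa>\<close> is
  chosen as \<open>1 / (1 + 16/9 + 9/16)\<close> to make them the rational numbers \<open>9/16\<close> and
  \<open>16/9\<close>.  Hence the maximum of \<open>\<phi>\<close> is attained at \<open>0\<close> or at \<open>16/9\<close>.
\<close>

lemma one_minus_Suc_exp_le:
  fixes s :: real
  assumes "s \<ge> 0"
  shows "1 - (1 + s) * exp (- s) \<le> 144 / 481 * s"
proof -
  define \<phi> where "\<phi> = (\<lambda>s::real. exp s * (1 - 144 / 481 * s) / (1 + s))"
  define \<phi>' where
    "\<phi>' = (\<lambda>s::real. - (144 / 481) * exp s * ((s - 16 / 9) * (s - 9 / 16)) / (1 + s)\<^sup>2)"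
  have deriv: "(\<phi> has_real_derivative \<phi>' x) (at x)" if "x \<ge> 0" for x
    unfolding \<phi>_def \<phi>'_def using that
    by (auto intro!: derivative_eq_intros simp: divide_simps power2_eq_square) algebra
  have antimono: "\<phi> b \<le> \<phi> a"
    if "0 \<le> a" "a \<le> b" "\<And>x. a \<le> x \<Longrightarrow> x \<le> b \<Longrightarrow> \<phi>' x \<le> 0" for a b
  proof (rule DERIV_nonpos_imp_nonincreasing[OF that(2)])
    fix x assume "a \<le> x" "x \<le> b"
    then show "\<exists>y. (\<phi> has_real_derivative y) (at x) \<and> y \<le> 0"
      using deriv[of x] that(1) that(3)[of x] by (intro exI[of _ "\<phi>' x"]) auto
  qed
  have mono: "\<phi> a \<le> \<phi> b"
    if "0 \<le> a" "a \<le> b" "\<And>x. a \<le> x \<Longrightarrow> x \<le> b \<Longrightarrow> \<phi>' x \<ge> 0" for a b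
  proof (rule DERIV_nonneg_imp_nondecreasing[OF that(2)])
    fix x assume "a \<le> x" "x \<le> b"
    then show "\<exists>y. (\<phi> has_real_derivative y) (at x) \<and> y \<ge> 0"
      using deriv[of x] that(1) that(3)[of x] by (intro exI[of _ "\<phi>' x"]) auto
  qed
  have at_max: "\<phi> (16 / 9) \<le> 1"
  proof -
    \<comment> \<open>The ninth power reduces the claim to \<open>exp 1 < 2.72\<close>.\<close>
    have "exp (16 / 9 :: real) ^ 9 = exp 1 ^ 16"
      by (simp flip: exp_of_nat_mult)
    also have "\<dots> \<le> (272 / 100) ^ 16"
      using e_less_272 by (intro power_mono) auto
    also have "\<dots> \<le> (9000000 :: real)"
      by (simp add: power_divide)
    also have "\<dots> \<le> (481 / 81) ^ 9"
      by (simp add: power_divide)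
    finally have "exp (16 / 9 :: real) \<le> 481 / 81"
      by (rule power_le_imp_le_base[of _ 8, simplified]) simp
    then show ?thesis
      by (simp add: \<phi>_def)
  qed
  have "\<phi> s \<le> 1"
  proof -
    consider "s \<le> 9 / 16" | "9 / 16 \<le> s" "s \<le> 16 / 9" | "16 / 9 \<le> s"
      by linarith
    then show ?thesis
    proof cases
      case 1
      have "\<phi>' x \<le> 0" if "0 \<le> x" "x \<le> s" for x
        using that 1 unfolding \<phi>'_def
        by (intro divide_nonpos_nonneg mult_nonpos_nonneg mult_nonneg_nonneg mult_nonpos_nonpos) auto
      then have "\<phi> s \<le> \<phi> 0"
        using assms by (intro antimono) auto
      then show ?thesis
        by (simp add: \<phi>_def)
    next
      case 2
      have "\<phi>' x \<ge> 0" if "s \<le> x" "x \<le> 16 / 9" for x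
        using that 2 unfolding \<phi>'_def
        by (intro divide_nonneg_nonneg mult_nonpos_nonpos mult_nonpos_nonneg) auto
      then have "\<phi> s \<le> \<phi> (16 / 9)"
        using 2 assms by (intro mono) auto
      then show ?thesis
        using at_max by linarith
    next
      case 3
      have "\<phi>' x \<le> 0" if "16 / 9 \<le> x" "x \<le> s" for x
        using that unfolding \<phi>'_def
        by (intro divide_nonpos_nonneg mult_nonpos_nonneg mult_nonneg_nonneg) auto
      then have "\<phi> s \<le> \<phi> (16 / 9)"
        using 3 by (intro antimono) auto
      then show ?thesis
        using at_max by linarith
    qed
  qed
  then have "exp s * (1 - 144 / 481 * s) \<le> 1 + s"
    using assms by (simp add: \<phi>_def divide_simps)
  then have "exp (- s) * (exp s * (1 - 144 / 481 * s)) \<le> exp (- s) * (1 + s)"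
    by (intro mult_left_mono) auto
  then show ?thesis
    by (simp add: mult.assoc[symmetric] exp_minus_inverse mult.commute flip: exp_add)
qed

section \<open>Uniform convergence of the powers\<close>

text \<open>
  This is \<open>norm_power_diff\<close>, the case \<open>M = 1\<close>, applied to \<open>z / M\<close> and
  \<open>w / M\<close>.  With \<open>M = exp (-l/2)\<close> the factor \<open>M ^ (n - 1)\<close> supplies the
  decay in \<open>s = n l\<close>.
\<close>

lemma norm_power_diff_le:
  fixes z w :: "'a::real_normed_field"
  assumes "norm z \<le> M" "norm w \<le> M" "M > 0"
  shows "norm (z ^ n - w ^ n) \<le> real n * M ^ (n - 1) * norm (z - w)"
proof (cases n)
  case (Suc k)
  have "norm ((z / of_real M) ^ n - (w / of_real M) ^ n)
      \<le> real n * norm (z / of_real M - w / of_real M)"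
    using assms by (intro norm_power_diff) (auto simp: norm_divide divide_simps)
  then have "norm (z ^ n - w ^ n) / M ^ n \<le> real n * (norm (z - w) / M)"
    using assms by (simp add: power_divide norm_divide norm_power flip: diff_divide_distrib)
  then show ?thesis
    using assms Suc by (simp add: field_simps)
qed simp

lemma norm_le_exp_half_near_0:
  fixes z :: "'a::real_normed_field"
  assumes "norm (z - of_real (exp (- l))) \<le> C * l\<^sup>2"
    and "0 < l" "l \<le> 1 / 2" "C * l \<le> 1 / 4"
  shows "norm z \<le> exp (- l / 2)"
proof -
  have "norm z \<le> norm (of_real (exp (- l)) :: 'a) + norm (z - of_real (exp (- l)))"
    by (rule norm_triangle_sub)
  also have "\<dots> \<le> exp (- l) + C * l * l"
    using assms(1) by (simp add: power2_eq_square mult.assoc)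
  \<comment> \<open>The gap between \<open>exp (-l)\<close> and \<open>exp (-l/2)\<close> is linear in \<open>l\<close>, so it
    absorbs the quadratic error.\<close>
  also have "C * l * l \<le> 1 / 2 * (l / 2)"
    using mult_right_mono[OF assms(4), of l] assms(2) by simp
  also have "1 / 2 * (l / 2) \<le> exp (- l) * (exp (l / 2) - 1)"
  proof (rule mult_mono)
    show "1 / 2 \<le> exp (- l)" "l / 2 \<le> exp (l / 2) - 1"
      using exp_ge_add_one_self[of "- l"] exp_ge_add_one_self[of "l / 2"] assms(3) by linarith+
  qed (use assms in auto)
  also have "exp (- l) + exp (- l) * (exp (l / 2) - 1) = exp (- l / 2)"
    by (simp add: algebra_simps flip: exp_add)
  finally show ?thesis by simp
qed

text \<open>
  Continuity makes the norm attain a maximum on the compact part of the half-line, and the limit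
  takes care of the rest.
\<close>

lemma norm_bounded_away_from_1:
  fixes f :: "real \<Rightarrow> 'a::real_normed_vector"
  assumes cont: "continuous_on {0<..} f"
    and less: "\<And>l. l > 0 \<Longrightarrow> norm (f l) < 1"
    and lim: "(f \<longlongrightarrow> L) at_top" "norm L < 1"
    and "\<delta> > 0"
  obtains \<rho> where "\<rho> < 1" "\<And>l. l \<ge> \<delta> \<Longrightarrow> norm (f l) \<le> \<rho>"
proof -
  obtain a where a: "norm L < a" "a < 1"
    using dense lim(2) by blast
  have "eventually (\<lambda>l. norm (f l) < a) at_top"
    using tendsto_norm[OF lim(1)] a(1) by (rule order_tendstoD)
  then obtain B where B: "\<And>l. l \<ge> B \<Longrightarrow> norm (f l) < a"
    by (auto simp: eventually_at_top_linorder)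
  define D where "D = max B \<delta>"
  have "continuous_on {\<delta>..D} (\<lambda>l. norm (f l))"
    using \<open>\<delta> > 0\<close> by (intro continuous_on_norm continuous_on_subset[OF cont]) auto
  then obtain x where x: "x \<in> {\<delta>..D}" "\<And>l. l \<in> {\<delta>..D} \<Longrightarrow> norm (f l) \<le> norm (f x)"
    using continuous_attains_sup[of "{\<delta>..D}" "\<lambda>l. norm (f l)"] by (auto simp: D_def)
  show thesis
  proof
    show "max a (norm (f x)) < 1"
      using a(2) x(1) less[of x] \<open>\<delta> > 0\<close> by auto
    show "norm (f l) \<le> max a (norm (f x))" if "l \<ge> \<delta>" for l
      using x(2)[of l] B[of l] that by (cases "l \<le> D") (auto simp: D_def le_max_iff_disj less_imp_le)
  qed
qed

text \<open>
  The weight \<open>(1 + s) / s\<close> is singular at \<open>0\<close>; there the factor \<open>l\<^sup>2\<close> of the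
  local error compensates for it.
\<close>

lemma power_tendsto_exp_weighted_uniformly:
  fixes f :: "real \<Rightarrow> 'a::real_normed_field"
  assumes cont: "continuous_on {0<..} f"
    and less: "\<And>l. l > 0 \<Longrightarrow> norm (f l) < 1"
    and lim: "(f \<longlongrightarrow> L) at_top" "norm L < 1"
    and consistent: "(\<lambda>l. f l - of_real (exp (- l))) \<in> O[at_right 0](\<lambda>l. of_real (l\<^sup>2))"
    and "\<epsilon> > 0"
  shows "eventually (\<lambda>J. \<forall>s>0.
           (1 + s) / s * norm (f (s / real J) ^ J - of_real (exp (- s))) \<le> \<epsilon>) sequentially"
proof -
  obtain C where "C > 0"
    and C: "eventually (\<lambda>l. norm (f l - of_real (exp (- l))) \<le> C * norm (of_real (l\<^sup>2) :: 'a))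
              (at_right 0)"
    using consistent by (elim landau_o.bigE)
  then obtain \<delta>0 where "\<delta>0 > 0"
    and \<delta>0: "\<And>l. 0 < l \<Longrightarrow> l < \<delta>0 \<Longrightarrow> norm (f l - of_real (exp (- l))) \<le> C * l\<^sup>2"
    unfolding eventually_at_right_field norm_of_real abs_power2 by blast
  \<comment> \<open>The last two bounds are what \<open>norm_le_exp_half_near_0\<close> asks of a step below \<open>\<delta>\<close>.\<close>
  define \<delta> where "\<delta> = min (\<delta>0 / 2) (min (1 / 2) (1 / (4 * C)))"
  have "\<delta> > 0" "\<delta> < \<delta>0" "\<delta> \<le> 1 / 2" "\<delta> \<le> 1 / (4 * C)"
    using \<open>\<delta>0 > 0\<close> \<open>C > 0\<close> by (auto simp: \<delta>_def)
  obtain \<rho>0 where "\<rho>0 < 1" and \<rho>0: "\<And>l. l \<ge> \<delta> \<Longrightarrow> norm (f l) \<le> \<rho>0"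
    using norm_bounded_away_from_1[OF cont less lim \<open>\<delta> > 0\<close>] by blast
  define \<rho> where "\<rho> = max \<rho>0 (exp (- \<delta>))"
  have "0 < \<rho>" "\<rho> < 1"
    using \<open>\<rho>0 < 1\<close> \<open>\<delta> > 0\<close> by (auto simp: \<rho>_def less_max_iff_disj)
  have small_step: "(1 + s) / s * norm (f (s / real J) ^ J - of_real (exp (- s))) \<le> 32 * C / real J"
    if "s > 0" "J \<ge> 2" "s / real J \<le> \<delta>" for s :: real and J :: nat
  proof -
    define l where "l = s / real J"
    have l: "0 < l" "l \<le> \<delta>" "s = real J * l"
      using that by (auto simp: l_def)
    have "C * l \<le> C * (1 / (4 * C))"
      using l \<open>\<delta> \<le> 1 / (4 * C)\<close> \<open>C > 0\<close> by (intro mult_left_mono) linarith+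
    then have "C * l \<le> 1 / 4"
      using \<open>C > 0\<close> by simp
    have err: "norm (f l - of_real (exp (- l))) \<le> C * l\<^sup>2"
      using \<delta>0 l \<open>\<delta> < \<delta>0\<close> by simp
    have "norm (f l) \<le> exp (- l / 2)"
      using err l \<open>\<delta> \<le> 1 / 2\<close> \<open>C * l \<le> 1 / 4\<close> by (intro norm_le_exp_half_near_0[of _ _ C]) auto
    moreover have "norm (of_real (exp (- l)) :: 'a) \<le> exp (- l / 2)"
      using l by simp
    ultimately have "norm (f l ^ J - of_real (exp (- l)) ^ J)
        \<le> real J * exp (- l / 2) ^ (J - 1) * norm (f l - of_real (exp (- l)))"
      by (intro norm_power_diff_le) auto
    also have "\<dots> \<le> real J * exp (- s / 4) * (C * l\<^sup>2)"
    proof -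
      have "real (J - 1) * (- l / 2) = - s / 2 + l / 2"
        using \<open>J \<ge> 2\<close> by (simp add: l(3) of_nat_diff field_simps)
      moreover have "2 * l \<le> s"
        unfolding l(3) using \<open>J \<ge> 2\<close> l(1) by (intro mult_right_mono) auto
      ultimately have "real (J - 1) * (- l / 2) \<le> - s / 4"
        by linarith
      have "exp (- l / 2) ^ (J - 1) = exp (real (J - 1) * (- l / 2))"
        by (simp flip: exp_of_nat_mult)
      also have "\<dots> \<le> exp (- s / 4)"
        using \<open>real (J - 1) * (- l / 2) \<le> - s / 4\<close> by (subst exp_le_cancel_iff)
      finally show ?thesis
        using err by (intro mult_mono) auto
    qed
    also have "of_real (exp (- l)) ^ J = (of_real (exp (- s)) :: 'a)"
      by (simp add: l(3) flip: of_real_power exp_of_nat_mult)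
    finally have "(1 + s) / s * norm (f l ^ J - of_real (exp (- s)))
        \<le> (1 + s) / s * (real J * exp (- s / 4) * (C * l\<^sup>2))"
      using \<open>s > 0\<close> by (intro mult_left_mono) auto
    also have "\<dots> = C / real J * ((1 + s) * s * exp (- s / 4))"
      using \<open>s > 0\<close> \<open>J \<ge> 2\<close> by (simp add: l_def power2_eq_square)
    also have "\<dots> \<le> C / real J * 32"
    proof -
      have "(1 + s) * s \<le> 32 * (1 + s / 4 + (s / 4)\<^sup>2 / 2)"
        using \<open>s > 0\<close> by (simp add: field_simps power2_eq_square)
      also have "\<dots> \<le> 32 * exp (s / 4)"
        using \<open>s > 0\<close> by (intro mult_left_mono exp_lower_Taylor_quadratic) auto
      finally have "(1 + s) * s * exp (- s / 4) \<le> 32"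
        by (simp add: exp_minus field_simps)
      then show ?thesis
        using \<open>C > 0\<close> by (intro mult_left_mono) auto
    qed
    finally show ?thesis
      by (simp add: l_def mult.commute)
  qed
  have large_step: "(1 + s) / s * norm (f (s / real J) ^ J - of_real (exp (- s))) \<le> 4 * \<rho> ^ J"
    if "s > 0" "J > 0" "1 / \<delta> \<le> real J" "s / real J \<ge> \<delta>" for s :: real and J :: nat
  proof -
    define l where "l = s / real J"
    have l: "l \<ge> \<delta>" "s = real J * l"
      using that by (auto simp: l_def)
    have "1 \<le> real J * \<delta>"
      using \<open>1 / \<delta> \<le> real J\<close> \<open>\<delta> > 0\<close> by (simp add: field_simps)
    also have "\<dots> \<le> s"
      using l by (simp add: mult_left_mono)
    finally have "(1 + s) / s \<le> 2"
      by (simp add: field_simps)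
    have "norm (f l ^ J) \<le> \<rho> ^ J"
      unfolding norm_power using \<rho>0[OF l(1)] by (intro power_mono) (auto simp: \<rho>_def)
    moreover have "norm (of_real (exp (- s)) :: 'a) \<le> \<rho> ^ J"
    proof -
      have "exp (- s) = exp (- l) ^ J"
        by (simp add: l(2) flip: exp_of_nat_mult)
      also have "\<dots> \<le> \<rho> ^ J"
        using l(1) by (intro power_mono) (auto simp: \<rho>_def le_max_iff_disj)
      finally show ?thesis by simp
    qed
    ultimately have "norm (f l ^ J - of_real (exp (- s))) \<le> 2 * \<rho> ^ J"
      using norm_triangle_ineq4[of "f l ^ J" "of_real (exp (- s))"] by linarith
    then have "(1 + s) / s * norm (f l ^ J - of_real (exp (- s))) \<le> 2 * (2 * \<rho> ^ J)"
      using \<open>(1 + s) / s \<le> 2\<close> by (intro mult_mono) auto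
    then show ?thesis
      by (simp add: l_def)
  qed
  have "(\<lambda>J. 32 * C / real J) \<longlonglongrightarrow> 0"
    by (rule lim_const_over_n)
  then have "eventually (\<lambda>J. 32 * C / real J < \<epsilon>) sequentially"
    using \<open>\<epsilon> > 0\<close> by (rule order_tendstoD)
  moreover have "(\<lambda>J. 4 * \<rho> ^ J) \<longlonglongrightarrow> 4 * 0"
    using \<open>0 < \<rho>\<close> \<open>\<rho> < 1\<close> by (intro tendsto_mult tendsto_const LIMSEQ_power_zero) auto
  then have "eventually (\<lambda>J. 4 * \<rho> ^ J < \<epsilon>) sequentially"
    using \<open>\<epsilon> > 0\<close> by (intro order_tendstoD) auto
  moreover have "eventually (\<lambda>J. 1 / \<delta> \<le> real J) sequentially"
    using filterlim_real_sequentially by (simp add: filterlim_at_top)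
  ultimately show ?thesis
    using eventually_ge_at_top[of 2]
  proof eventually_elim
    case (elim J)
    show ?case
    proof (intro allI impI)
      fix s :: real
      assume "s > 0"
      then show "(1 + s) / s * norm (f (s / real J) ^ J - of_real (exp (- s))) \<le> \<epsilon>"
        using small_step[of s J] large_step[of s J] elim by (cases "s / real J \<le> \<delta>") auto
    qed
  qed
qed

section \<open>The bound for rational functions\<close>

lemma continuous_on_rat_eval:
  fixes r :: "'a::{field_gcd, real_normed_field} poly fract"
  assumes "\<And>l. l \<in> S \<Longrightarrow> pole_free_at r (g l)" and "continuous_on S g"
  shows "continuous_on S (\<lambda>l. rat_eval r (g l))"
  using assms unfolding rat_eval_def pole_free_at_def
  by (intro continuous_on_divide continuous_on_poly) auto

theorem theorem3p3:
  fixes q m :: nat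
    and r :: "'a::{field_gcd, real_normed_field, banach} poly fract"
    and p :: "nat \<Rightarrow> 'a poly fract"
    and c :: "nat \<Rightarrow> real"
  assumes q: "q \<ge> 1"
    and m: "m \<ge> 1"
    and c_range: "\<And>i. i \<in> {1..m} \<Longrightarrow> c i \<in> {0..1}"
    and c_distinct: "inj_on c {1..m}"
    and P1_r: "\<forall>l::real. l > 0 \<longrightarrow>
          pole_free_at r (of_real (- l)) \<and> norm (rat_eval r (of_real (- l))) < 1"
    and P1_p: "\<exists>C::real. \<forall>i\<in>{1..m}. \<forall>l::real. l > 0 \<longrightarrow>
          pole_free_at (p i) (of_real (- l)) \<and> norm (rat_eval (p i) (of_real (- l))) \<le> C"
    and P1_deg: "\<forall>i\<in>{1..m}. strictly_proper (p i)"
    and P2_r: "(\<lambda>l::real. rat_eval r (of_real (- l)) - of_real (exp (- l)))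
          \<in> O[at 0](\<lambda>l. of_real (l ^ (q + 1)))"
    and P2_p: "\<forall>j\<le>q.
          (\<lambda>l::real. (\<Sum>i=1..m. of_real (c i ^ j) * rat_eval (p i) (of_real (- l)))
             - of_real (fact j / (- l) ^ (j + 1)
                 * (exp (- l) - (\<Sum>k=0..j. (- l) ^ k / fact k))))
          \<in> O[at 0](\<lambda>l. of_real (l ^ (q - j)))"
    and P3: "\<exists>r_inf. ((\<lambda>l::real. rat_eval r (of_real (- l))) \<longlongrightarrow> r_inf) at_top \<and> norm r_inf < 1"
  shows "\<exists>J_star::nat. J_star > 0 \<and> (\<forall>J::nat. J \<ge> J_star \<longrightarrow>
          (SUP s\<in>{0::real<..}.
             ereal (norm ((of_real (1 + s) * rat_eval r (of_real (- (s / real J))) ^ J - 1)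
                          / of_real s)))
          \<le> ereal 0.3)"
proof -
  define f where "f = (\<lambda>l::real. rat_eval r (of_real (- l)))"
  define \<epsilon> :: real where "\<epsilon> = 0.3 - 144 / 481"
  obtain r_inf where r_inf: "(f \<longlongrightarrow> r_inf) at_top" "norm r_inf < 1"
    using P3 unfolding f_def by blast
  have cont: "continuous_on {0<..} f"
    unfolding f_def using P1_r by (intro continuous_on_rat_eval continuous_intros) auto
  have less: "norm (f l) < 1" if "l > 0" for l
    using P1_r that by (simp add: f_def)
  have "(\<lambda>l. of_real (l ^ (q + 1)) :: 'a) \<in> O[at_right 0](\<lambda>l. of_real (l\<^sup>2))"
  proof (rule landau_o.bigI[of 1])
    show "eventually (\<lambda>l. norm (of_real (l ^ (q + 1)) :: 'a) \<le> 1 * norm (of_real (l\<^sup>2) :: 'a))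
            (at_right 0)"
      using eventually_at_right_real[of 0 1]
    proof (rule eventually_mono)
      fix l :: real
      assume "l \<in> {0<..<1}"
      then have "l ^ (q + 1) \<le> l\<^sup>2"
        using q by (intro power_decreasing) auto
      then show "norm (of_real (l ^ (q + 1)) :: 'a) \<le> 1 * norm (of_real (l\<^sup>2) :: 'a)"
        using \<open>l \<in> {0<..<1}\<close> by (simp only: norm_of_real) simp
    qed simp
  qed simp
  moreover have "(\<lambda>l. f l - of_real (exp (- l))) \<in> O[at_right 0](\<lambda>l. of_real (l ^ (q + 1)))"
    using landau_o.big.filter_mono[OF at_le[of "{0<..}" UNIV 0]] P2_r
    unfolding f_def by auto
  ultimately have consistent:
      "(\<lambda>l. f l - of_real (exp (- l))) \<in> O[at_right 0](\<lambda>l. of_real (l\<^sup>2))"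
    by (rule landau_o.big_trans[rotated])
  have "eventually (\<lambda>J. \<forall>s>0.
          (1 + s) / s * norm (f (s / real J) ^ J - of_real (exp (- s))) \<le> \<epsilon>) sequentially"
    using cont less r_inf consistent
    by (rule power_tendsto_exp_weighted_uniformly) (auto simp: \<epsilon>_def)
  then obtain N where N: "\<And>J s. J \<ge> N \<Longrightarrow> s > 0 \<Longrightarrow>
      (1 + s) / s * norm (f (s / real J) ^ J - of_real (exp (- s))) \<le> \<epsilon>"
    by (auto simp: eventually_sequentially)
  have bound: "norm ((of_real (1 + s) * f (s / real J) ^ J - 1) / of_real s) \<le> 0.3"
    if "J \<ge> N" "s > 0" for J :: nat and s :: real
  proof -
    have "(of_real (1 + s) * f (s / real J) ^ J - 1) / of_real s
        = of_real ((1 + s) / s) * (f (s / real J) ^ J - of_real (exp (- s)))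
          - of_real ((1 - (1 + s) * exp (- s)) / s)"
      using \<open>s > 0\<close> by (simp add: field_simps)
    also have "norm \<dots> \<le> norm (of_real ((1 + s) / s) * (f (s / real J) ^ J - of_real (exp (- s))))
          + norm (of_real ((1 - (1 + s) * exp (- s)) / s) :: 'a)"
      by (rule norm_triangle_ineq4)
    also have "norm (of_real ((1 + s) / s) * (f (s / real J) ^ J - of_real (exp (- s)))) \<le> \<epsilon>"
      using N[OF that] \<open>s > 0\<close> by (simp only: norm_mult norm_of_real) simp
    also have "norm (of_real ((1 - (1 + s) * exp (- s)) / s) :: 'a) \<le> 144 / 481"
    proof -
      have "(1 + s) * exp (- s) \<le> exp s * exp (- s)"
        by (intro mult_right_mono exp_ge_add_one_self) auto
      also have "\<dots> = 1"
        by (simp flip: exp_add)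
      finally have "0 \<le> 1 - (1 + s) * exp (- s)"
        by simp
      then have "norm (of_real ((1 - (1 + s) * exp (- s)) / s) :: 'a)
          = (1 - (1 + s) * exp (- s)) / s"
        unfolding norm_of_real using \<open>s > 0\<close> by (intro abs_of_nonneg divide_nonneg_pos)
      also have "\<dots> \<le> 144 / 481"
        using one_minus_Suc_exp_le[of s] \<open>s > 0\<close> by (simp add: pos_divide_le_eq)
      finally show ?thesis .
    qed
    finally show ?thesis
      by (simp add: \<epsilon>_def)
  qed
  show ?thesis
  proof (intro exI[of _ "Suc N"] conjI allI impI SUP_least)
    fix J :: nat and s :: real
    assume "J \<ge> Suc N" "s \<in> {0<..}"
    then show "ereal (norm ((of_real (1 + s) * rat_eval r (of_real (- (s / real J))) ^ J - 1)
        / of_real s)) \<le> ereal 0.3"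
      using bound[of J s] unfolding f_def ereal_less_eq(3) by simp
  qed simp
qed

end
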